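(* Let $p$ be a prime number and let $H$ be a $p\times p$ circulant complex Hadamard matrix all of whose entries are $p$-th roots of unity (i.e. $H\in C^{circ}_p(p)$). Then $H$ is equivalent to the Fourier matrix $F_p=(w^{ij})_{i,j=0}^{p-1}$, $w=e^{2\pi i/p}$.
   Context: A complex Hadamard matrix of order $n$ is a matrix $H\in M_n(\mathbb C)$ with $|H_{ij}|=1$ for all $i,j$ and pairwise orthogonal rows (equivalently $H/\sqrt n$ is unitary). A matrix $H=(H_{ij})_{i,j=0}^{n-1}$ is circulant if $H_{ij}$ depends only on $j-i$ modulo $n$. $C^{circ}_n(l)$ denotes the set of $n\times n$ circulant complex Hadamard matrices whose entries are all $l$-th roots of unity. Two complex Hadamard matrices are equivalent if one can be obtained from the other by permuting rows, permuting columns, and multiplying individual rows and individual columns by complex numbers of modulus one. *)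

theory Defs
  imports "HOL-Analysis.Analysis"
begin

text \<open>n x n matrices are represented as functions nat => nat => complex,
  only the entries with indices in {0..<n} are relevant.\<close>

definition complex_hadamard :: "nat \<Rightarrow> (nat \<Rightarrow> nat \<Rightarrow> complex) \<Rightarrow> bool" where
  "complex_hadamard n H \<longleftrightarrow>
     (\<forall>i<n. \<forall>j<n. norm (H i j) = 1) \<and>
     (\<forall>i<n. \<forall>k<n. i \<noteq> k \<longrightarrow> (\<Sum>j<n. H i j * cnj (H k j)) = 0)"

definition circulant :: "nat \<Rightarrow> (nat \<Rightarrow> nat \<Rightarrow> complex) \<Rightarrow> bool" where
  "circulant n H \<longleftrightarrow>
     (\<forall>i<n. \<forall>j<n. \<forall>i'<n. \<forall>j'<n.
        (int j - int i) mod int n = (int j' - int i') mod int n \<longrightarrow> H i j = H i' j')"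

definition entries_roots_of_unity :: "nat \<Rightarrow> nat \<Rightarrow> (nat \<Rightarrow> nat \<Rightarrow> complex) \<Rightarrow> bool" where
  "entries_roots_of_unity n l H \<longleftrightarrow> (\<forall>i<n. \<forall>j<n. H i j ^ l = 1)"

definition circ_hadamard_set :: "nat \<Rightarrow> nat \<Rightarrow> (nat \<Rightarrow> nat \<Rightarrow> complex) set" where
  "circ_hadamard_set n l =
     {H. complex_hadamard n H \<and> circulant n H \<and> entries_roots_of_unity n l H}"

definition hadamard_equivalent :: "nat \<Rightarrow> (nat \<Rightarrow> nat \<Rightarrow> complex) \<Rightarrow> (nat \<Rightarrow> nat \<Rightarrow> complex) \<Rightarrow> bool" where
  "hadamard_equivalent n H K \<longleftrightarrow>
     (\<exists>\<sigma> \<tau> (a :: nat \<Rightarrow> complex) (b :: nat \<Rightarrow> complex).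
        \<sigma> permutes {..<n} \<and> \<tau> permutes {..<n} \<and>
        (\<forall>i<n. norm (a i) = 1) \<and> (\<forall>j<n. norm (b j) = 1) \<and>
        (\<forall>i<n. \<forall>j<n. H i j = a i * b j * K (\<sigma> i) (\<tau> j)))"

definition fourier_matrix :: "nat \<Rightarrow> nat \<Rightarrow> nat \<Rightarrow> complex" where
  "fourier_matrix n i j = cis (2 * pi / real n) ^ (i * j)"

end

theory Submission
  imports Defs "HOL-Number_Theory.Residue_Primitive_Roots"
begin

text \<open>
  Write the first row as \<open>H 0 y = w ^ e y\<close>. Since the minimal polynomial of \<open>w\<close> is
  \<open>1 + x + \<dots> + x ^ (p - 1)\<close>, orthogonality of the rows says that for every \<open>d \<noteq> 0\<close> the map
  \<open>y \<mapsto> e (y + d) - e y\<close> permutes the residues mod \<open>p\<close>, i.e. \<open>e\<close> is planar. It remains to see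
  that a planar function \<open>f\<close> on a prime field is a quadratic polynomial, as
  \<open>a (j - i)\<^sup>2 + b (j - i) + c\<close> differs from \<open>- 2 a i j\<close> by a function of \<open>i\<close> plus a function of \<open>j\<close>.

  Planarity makes \<open>\<Sum>x y. (f x - f y) ^ k * (x - y) ^ l\<close> vanish mod \<open>p\<close> for \<open>k \<le> p - 2\<close>. This forces
  the moments \<open>\<Sum>x. f x ^ i * x ^ j\<close> with \<open>2 (i + j) \<le> p - 2\<close> to vanish. If \<open>f\<close> has degree \<open>n \<ge> 3\<close>
  and \<open>p - 1 = n i + r\<close> with \<open>r < n\<close>, then the moment \<open>(i, r)\<close> is nonzero, hence
  \<open>(n - 2) i \<le> r < n\<close>, which leaves only \<open>p = 2 n - 1\<close>. In that case \<open>f (x + 1) - f x\<close> has degree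
  \<open>(p - 1) / 2\<close>, so its square has nonzero sum, and it is not a permutation.
\<close>

hide_const (open) UnivPoly.coeff UnivPoly.monom Module.smult

subsection \<open>Power sums and interpolation modulo a prime\<close>

text \<open>Multiplication by a primitive root \<open>g\<close> permutes the residues, so the sum
  \<open>S\<close> satisfies \<open>S = g ^ k * S\<close> mod \<open>p\<close>, and \<open>p\<close>
  does not divide \<open>g ^ k - 1\<close> for \<open>0 < k < p - 1\<close>. For
  \<open>k = 0\<close> the sum is \<open>p\<close>, as \<open>0 ^ 0 = 1\<close>.\<close>

lemma sum_powers_mod_prime:
  fixes p k :: nat
  assumes p: "prime p" and k: "k < p - 1"
  shows "int p dvd (\<Sum>x<p. int x ^ k)"
proof (cases "k = 0")
  case False
  have p1: "p > 1" using p by (rule prime_gt_1_nat)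
  obtain g where g: "residue_primroot p g"
    using prime_primitive_root_exists[of p] p p1 by auto
  then have cop: "coprime p g" and ord: "ord p g = p - 1"
    using p by (auto simp: residue_primroot_def totient_prime)
  have "\<not> [g ^ k = 1] (mod p)"
    using ord ord_divides[of g k p] False k nat_dvd_not_less by auto
  then have nd: "\<not> int p dvd int g ^ k - 1"
    by (metis cong_iff_dvd_diff cong_int_iff of_nat_1 of_nat_power)
  have bij: "bij_betw (\<lambda>x. (g * x) mod p) {..<p} {..<p}"
  proof (rule bij_betwI')
    fix x y assume xy: "x \<in> {..<p}" "y \<in> {..<p}"
    show "(g * x) mod p = (g * y) mod p \<longleftrightarrow> x = y"
      using xy cong_mult_lcancel_nat[of g p x y] cop
      by (auto simp: cong_def coprime_commute)
  next
    fix y assume y: "y \<in> {..<p}"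
    obtain h where h: "[g * h = 1] (mod p)"
      using cong_solve_coprime_nat[of g p] cop by (auto simp: coprime_commute)
    have "[g * ((h * y) mod p) = g * h * y] (mod p)"
      by (simp add: cong_def mod_mult_right_eq mult.assoc)
    also have "[g * h * y = 1 * y] (mod p)"
      using h by (rule cong_scalar_right)
    finally have "(g * ((h * y) mod p)) mod p = y" using y by (simp add: cong_def)
    moreover have "(h * y) mod p \<in> {..<p}" using p1 by simp
    ultimately show "\<exists>x\<in>{..<p}. y = (g * x) mod p" by (metis (full_types))
  qed (use p1 in auto)
  have "(\<Sum>x<p. int x ^ k) = (\<Sum>x<p. int ((g * x) mod p) ^ k)"
    using sum.reindex_bij_betw[OF bij, of "\<lambda>x. int x ^ k"] by simp
  also have "[\<dots> = (\<Sum>x<p. (int g * int x) ^ k)] (mod int p)"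
    by (intro cong_sum cong_pow) (simp add: cong_def zmod_int)
  also have "(\<Sum>x<p. (int g * int x) ^ k) = int g ^ k * (\<Sum>x<p. int x ^ k)"
    by (simp add: power_mult_distrib sum_distrib_left)
  finally have "int p dvd (\<Sum>x<p. int x ^ k) - int g ^ k * (\<Sum>x<p. int x ^ k)"
    by (simp add: cong_iff_dvd_diff)
  then have "int p dvd (int g ^ k - 1) * (\<Sum>x<p. int x ^ k)"
    by (simp add: algebra_simps dvd_diff_commute)
  then show ?thesis using nd p by (simp add: prime_dvd_mult_iff)
qed simp

lemma fermat_int:
  assumes "prime p" "\<not> p dvd x"
  shows "[int x ^ (p - 1) = 1] (mod int p)"
  using fermat_theorem[OF assms] by (metis cong_int_iff of_nat_1 of_nat_power)

lemma sum_powers_pred_mod_prime: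
  assumes p: "prime p"
  shows "[(\<Sum>x<p. int x ^ (p - 1)) = - 1] (mod int p)"
proof -
  have p1: "p > 1" using p by (rule prime_gt_1_nat)
  have "(\<Sum>x<p. int x ^ (p - 1)) = (\<Sum>x\<in>{1..<p}. int x ^ (p - 1))"
    using p1 by (intro sum.mono_neutral_right) (auto simp: Suc_le_eq)
  also have "[\<dots> = (\<Sum>x\<in>{1..<p}. 1)] (mod int p)"
    by (intro cong_sum fermat_int[OF p]) (auto dest: dvd_imp_le)
  also have "(\<Sum>x\<in>{1..<p}. 1) = int p - 1" using p1 by simp
  also have "[int p - 1 = - 1] (mod int p)" by (simp add: cong_iff_dvd_diff)
  finally show ?thesis .
qed

lemma poly_altdef_le:
  fixes P :: "'a::comm_semiring_1 poly"
  assumes "degree P \<le> n"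
  shows "poly P x = (\<Sum>i\<le>n. coeff P i * x ^ i)"
  unfolding poly_altdef using assms
  by (intro sum.mono_neutral_left) (auto simp: coeff_eq_0)

text \<open>Among the exponents up to \<open>p - 1\<close>, only the last has a power sum that
  survives mod \<open>p\<close>. Summing over the field thus reads off a single coefficient.\<close>

lemma sum_poly_mod_prime:
  fixes G :: "int poly"
  assumes p: "prime p" and deg: "degree G \<le> p - 1"
  shows "[(\<Sum>x<p. poly G (int x)) = - coeff G (p - 1)] (mod int p)"
proof -
  have p1: "p > 1" using p by (rule prime_gt_1_nat)
  have "(\<Sum>x<p. poly G (int x)) = (\<Sum>x<p. \<Sum>i\<le>p-1. coeff G i * int x ^ i)"
    by (intro sum.cong refl poly_altdef_le deg)
  also have "\<dots> = (\<Sum>i\<le>p-1. coeff G i * (\<Sum>x<p. int x ^ i))"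
    by (subst sum.swap) (simp add: sum_distrib_left)
  also have "{..p-1} = insert (p-1) {..<p-1}" by auto
  also have "(\<Sum>i\<in>insert (p-1) {..<p-1}. coeff G i * (\<Sum>x<p. int x ^ i)) =
      coeff G (p-1) * (\<Sum>x<p. int x ^ (p-1)) + (\<Sum>i<p-1. coeff G i * (\<Sum>x<p. int x ^ i))"
    by simp
  also have "[\<dots> = coeff G (p-1) * (-1) + (\<Sum>i<p-1. 0)] (mod int p)"
    using sum_powers_pred_mod_prime[OF p] sum_powers_mod_prime[OF p]
    by (intro cong_add cong_sum cong_scalar_left) (auto simp: cong_0_iff)
  finally show ?thesis by simp
qed

text \<open>Lagrange interpolation: by Fermat, \<open>1 - (x - a) ^ (p - 1)\<close> is the indicator
  of \<open>x = a\<close> mod \<open>p\<close>. The last property makes the integer degree agree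
  with the degree mod \<open>p\<close>.\<close>

lemma interpolation_mod_prime:
  fixes f :: "nat \<Rightarrow> int"
  assumes p: "prime p"
  obtains F :: "int poly" where "degree F \<le> p - 1"
    and "\<And>x. x < p \<Longrightarrow> [poly F (int x) = f x] (mod int p)"
    and "F = 0 \<or> \<not> int p dvd lead_coeff F"
proof -
  have p1: "p > 1" using p by (rule prime_gt_1_nat)
  define F0 where "F0 = (\<Sum>a<p. smult (f a) (1 - [:- int a, 1:] ^ (p - 1)))"
  \<comment> \<open>Reduction turns every coefficient divisible by \<open>p\<close> into
    \<open>0\<close>, so none of these can be the leading one.\<close>
  define F where "F = map_poly (\<lambda>c. c mod int p) F0"
  have cF: "coeff F i = coeff F0 i mod int p" for i
    by (simp add: F_def coeff_map_poly)
  have d0: "degree F0 \<le> p - 1"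
    unfolding F0_def
    by (intro degree_sum_le order.trans[OF degree_smult_le] degree_diff_le) 
       (auto simp: degree_linear_power)
  have d: "degree F \<le> p - 1"
    using d0 by (intro degree_le) (simp add: cF coeff_eq_0)
  show ?thesis
  proof (rule that[OF d])
    fix x assume x: "x < p"
    have "poly F (int x) = (\<Sum>i\<le>p-1. coeff F i * int x ^ i)"
      by (rule poly_altdef_le[OF d])
    also have "[\<dots> = (\<Sum>i\<le>p-1. coeff F0 i * int x ^ i)] (mod int p)"
      by (intro cong_sum cong_scalar_right) (simp add: cF cong_def)
    also have "(\<Sum>i\<le>p-1. coeff F0 i * int x ^ i) = poly F0 (int x)"
      by (rule poly_altdef_le[OF d0, symmetric])
    also have "\<dots> = (\<Sum>a<p. f a * (1 - (int x - int a) ^ (p - 1)))"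
      by (simp add: F0_def poly_sum poly_power algebra_simps)
    also have "[\<dots> = (\<Sum>a<p. if a = x then f a else 0)] (mod int p)"
    proof (intro cong_sum)
      fix a assume a: "a \<in> {..<p}"
      show "[f a * (1 - (int x - int a) ^ (p - 1)) = (if a = x then f a else 0)] (mod int p)"
      proof (cases "a = x")
        case False
        \<comment> \<open>\<open>fermat_int\<close> speaks of natural numbers, so the possibly
          negative difference is replaced by its residue.\<close>
        let ?m = "nat ((int x - int a) mod int p)"
        have m: "int ?m = (int x - int a) mod int p" using p1 by simp
        have "\<not> p dvd ?m"
        proof
          assume "p dvd ?m"
          then have "int p dvd (int x - int a) mod int p" using m by (metis int_dvd_int_iff)
          then have "[int x = int a] (mod int p)"
            by (simp add: dvd_mod_iff cong_iff_dvd_diff)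
          then show False using a x False by (simp add: cong_def)
        qed
        then have "[int ?m ^ (p - 1) = 1] (mod int p)" by (rule fermat_int[OF p])
        moreover have "[int ?m ^ (p-1) = (int x - int a) ^ (p - 1)] (mod int p)"
          unfolding m by (intro cong_pow) (simp add: cong_def)
        ultimately have "[(int x - int a) ^ (p - 1) = 1] (mod int p)"
          using cong_sym cong_trans by blast
        then have "int p dvd 1 - (int x - int a) ^ (p - 1)" by (meson cong_iff_dvd_diff cong_sym)
        then show ?thesis using False by (simp add: cong_0_iff)
      qed (use p1 in \<open>simp add: power_0_left\<close>)
    qed
    also have "(\<Sum>a<p. if a = x then f a else 0) = f x" using x by simp
    finally show "[poly F (int x) = f x] (mod int p)" .
  next
    show "F = 0 \<or> \<not> int p dvd lead_coeff F"
    proof (intro disjCI)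
      assume "\<not> \<not> int p dvd lead_coeff F"
      then have "lead_coeff F = 0" by (simp add: cF dvd_eq_mod_eq_0)
      then show "F = 0" by simp
    qed
  qed
qed

subsection \<open>Planar functions on a prime field\<close>

text \<open>Also known as perfect nonlinear functions. Arguments wrap around mod \<open>p\<close>
  and values are integers read mod \<open>p\<close>, so \<open>f\<close> matters only on
  \<open>{..<p}\<close>.\<close>

definition planar :: "nat \<Rightarrow> (nat \<Rightarrow> int) \<Rightarrow> bool" where
  "planar p f \<longleftrightarrow> (\<forall>d\<in>{1..<p}.
     bij_betw (\<lambda>y. (f ((y + d) mod p) - f y) mod int p) {..<p} {0..<int p})"

lemma planar_sum_powers:
  assumes p: "prime p" and f: "planar p f" and d: "d \<in> {1..<p}" and k: "k < p - 1"
  shows "int p dvd (\<Sum>y<p. (f ((y + d) mod p) - f y) ^ k)"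
proof -
  have "[(\<Sum>y<p. (f ((y + d) mod p) - f y) ^ k) =
         (\<Sum>y<p. ((f ((y + d) mod p) - f y) mod int p) ^ k)] (mod int p)"
    by (intro cong_sum cong_pow) (simp add: cong_def)
  also have "(\<Sum>y<p. ((f ((y + d) mod p) - f y) mod int p) ^ k) = (\<Sum>c\<in>{0..<int p}. c ^ k)"
    using f d unfolding planar_def by (intro sum.reindex_bij_betw) auto
  also have "\<dots> = (\<Sum>x<p. int x ^ k)"
    by (rule sum.reindex_bij_witness[of _ int nat]) auto
  finally show ?thesis
    using sum_powers_mod_prime[OF p k] cong_dvd_iff by blast
qed

lemma bij_betw_add_mod:
  fixes p y :: nat
  assumes "p > 0"
  shows "bij_betw (\<lambda>d. (y + d) mod p) {..<p} {..<p}"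
proof -
  have "inj_on (\<lambda>d. (y + d) mod p) {..<p}"
  proof (rule inj_onI)
    fix a b assume "a \<in> {..<p}" "b \<in> {..<p}" "(y + a) mod p = (y + b) mod p"
    then show "a = b" using cong_add_lcancel_nat[of y a b p] by (simp add: cong_def)
  qed
  moreover have "(\<lambda>d. (y + d) mod p) ` {..<p} \<subseteq> {..<p}" using assms by auto
  ultimately show ?thesis
    by (simp add: bij_betw_def endo_inj_surj)
qed

text \<open>Substituting \<open>x = y + d\<close> mod \<open>p\<close> collects the terms of fixed
  \<open>d\<close> into \<open>d ^ j\<close> times a power sum of differences, which planarity makes
  vanish.\<close>

lemma planar_double_sum:
  assumes p: "prime p" and f: "planar p f" and i: "i < p - 1"
  shows "int p dvd (\<Sum>x<p. \<Sum>y<p. (f x - f y) ^ i * (int x - int y) ^ j)"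
proof -
  have p0: "p > 0" using p by (rule prime_gt_0_nat)
  define S where "S d = (\<Sum>y<p. (f ((y + d) mod p) - f y) ^ i)" for d
  define g where "g x y = (f x - f y) ^ i * (int x - int y) ^ j" for x y
  have "(\<Sum>x<p. \<Sum>y<p. g x y) = (\<Sum>y<p. \<Sum>x<p. g x y)"
    by (rule sum.swap)
  also have "\<dots> = (\<Sum>y<p. \<Sum>d<p. g ((y + d) mod p) y)"
    by (intro sum.cong refl sum.reindex_bij_betw[OF bij_betw_add_mod[OF p0], symmetric])
  finally have "(\<Sum>x<p. \<Sum>y<p. g x y) = (\<Sum>d<p. \<Sum>y<p. g ((y + d) mod p) y)"
    by (subst (2) sum.swap)
  moreover have "[(\<Sum>d<p. \<Sum>y<p. g ((y + d) mod p) y) = (\<Sum>d<p. int d ^ j * S d)] (mod int p)"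
    unfolding S_def g_def sum_distrib_left mult.commute[of "int _ ^ j"]
    by (intro cong_sum cong_scalar_left cong_pow) (simp add: zmod_int cong_def mod_diff_left_eq)
  moreover have "int p dvd (\<Sum>d<p. int d ^ j * S d)"
  proof (rule dvd_sum, rule dvd_mult)
    fix d assume d: "d \<in> {..<p}"
    show "int p dvd S d"
    proof (cases "d = 0")
      case True
      \<comment> \<open>All differences are \<open>0\<close> here; the factor \<open>p\<close> is
        what helps when \<open>i = 0\<close>, where each summand is \<open>1\<close>.\<close>
      then have "S d = int p * 0 ^ i" by (simp add: S_def)
      then show ?thesis by simp
    next
      case False
      then show ?thesis using d unfolding S_def by (intro planar_sum_powers[OF p f _ i]) auto
    qed
  qed
  ultimately have "int p dvd (\<Sum>x<p. \<Sum>y<p. g x y)" by (simp only: cong_dvd_iff)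
  then show ?thesis by (simp only: g_def)
qed

section \<open>Moments of planar functions\<close>

lemma prime_not_dvd_choose:
  assumes "prime (p::nat)" "n < p" "k \<le> n"
  shows "\<not> p dvd n choose k"
  using assms binomial_fact_lemma[of k n]
  by (metis dvd_mult linorder_not_less prime_dvd_fact_iff)

definition moment :: "nat \<Rightarrow> (nat \<Rightarrow> int) \<Rightarrow> nat \<Rightarrow> nat \<Rightarrow> int" where
  "moment p f i j = (\<Sum>x<p. f x ^ i * int x ^ j)"

text \<open>Expanding both powers binomially separates the variables, so each term factors into a
  sum over \<open>x\<close> and a sum over \<open>y\<close>.\<close>

lemma double_sum_moments:
  "(\<Sum>x<p. \<Sum>y<p. (f x - f y) ^ a * (int x - int y) ^ b) =
   (\<Sum>(u, v)\<in>{..a} \<times> {..b}. of_nat (a choose u) * of_nat (b choose v) * (-1) ^ (a - u + (b - v)) *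
       moment p f u v * moment p f (a - u) (b - v))"
proof -
  have ex: "(s - t) ^ n = (\<Sum>u\<le>n. of_nat (n choose u) * (-1) ^ (n - u) * s ^ u * t ^ (n - u))"
    for s t :: int and n
    using binomial_ring[of s "- t" n] by (simp add: power_minus[of t] mult_ac)
  have "(f x - f y) ^ a * (int x - int y) ^ b =
     (\<Sum>(u, v)\<in>{..a} \<times> {..b}. of_nat (a choose u) * of_nat (b choose v) * (-1) ^ (a - u + (b - v)) *
       (f x ^ u * int x ^ v) * (f y ^ (a - u) * int y ^ (b - v)))" for x y
    unfolding ex sum_product sum.cartesian_product
    by (intro sum.cong refl) (auto simp: power_add mult_ac)
  then have "(\<Sum>x<p. \<Sum>y<p. (f x - f y) ^ a * (int x - int y) ^ b) =
     (\<Sum>x<p. \<Sum>y<p. \<Sum>(u, v)\<in>{..a} \<times> {..b}. of_nat (a choose u) * of_nat (b choose v) * (-1) ^ (a - u + (b - v)) *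
       (f x ^ u * int x ^ v) * (f y ^ (a - u) * int y ^ (b - v)))" by simp
  also have "\<dots> = (\<Sum>(u, v)\<in>{..a} \<times> {..b}. \<Sum>x<p. \<Sum>y<p. of_nat (a choose u) * of_nat (b choose v) * (-1) ^ (a - u + (b - v)) *
       (f x ^ u * int x ^ v) * (f y ^ (a - u) * int y ^ (b - v)))"
    (is "?L = (\<Sum>(u, v)\<in>?W. \<Sum>x<p. \<Sum>y<p. ?g u v x y)")
  proof -
    have "?L = (\<Sum>x<p. \<Sum>w\<in>?W. \<Sum>y<p. ?g (fst w) (snd w) x y)"
      by (intro sum.cong refl) (subst sum.swap, simp add: case_prod_unfold)
    also have "\<dots> = (\<Sum>w\<in>?W. \<Sum>x<p. \<Sum>y<p. ?g (fst w) (snd w) x y)" by (rule sum.swap)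
    finally show ?thesis by (simp add: case_prod_unfold)
  qed
  also have "\<dots> = (\<Sum>(u, v)\<in>{..a} \<times> {..b}. of_nat (a choose u) * of_nat (b choose v) * (-1) ^ (a - u + (b - v)) *
       moment p f u v * moment p f (a - u) (b - v))"
    unfolding moment_def by (intro sum.cong refl) (auto simp: sum_product sum_distrib_left mult_ac)
  finally show ?thesis .
qed

text \<open>In the double sum with exponents \<open>2 * i\<close> and \<open>2 * j\<close>,
  induction kills all terms but the central one. That one is, up to sign, the square of the moment
  times binomial coefficients prime to \<open>p\<close>.\<close>

lemma planar_moments:
  assumes p: "prime p" and f: "planar p f"
  shows "2 * (i + j) \<le> p - 2 \<Longrightarrow> int p dvd moment p f i j"
\<comment> \<open>The total degree alone would not settle the terms with
  \<open>u + v = i + j\<close>; the second component breaks these ties.\<close>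
proof (induction "(i + j, i)" arbitrary: i j rule: wf_induct_rule[OF wf_lex_prod[OF wf_less_than wf_less_than]])
  case (1 i j)
  have p1: "p > 1" using p by (rule prime_gt_1_nat)
  have IH: "int p dvd moment p f u v" if "u + v < i + j \<or> u + v = i + j \<and> u < i" for u v
    using 1(1)[of u v] that 1(2) by auto
  define T where "T = (\<lambda>(u, v). of_nat (2*i choose u) * of_nat (2*j choose v) * (-1) ^ (2*i - u + (2*j - v)) *
       moment p f u v * moment p f (2*i - u) (2*j - v))"
  \<comment> \<open>For all other \<open>(u, v)\<close>, either \<open>(u, v)\<close> or its complement in \<open>(2 i, 2 j)\<close> precedes \<open>(i, j)\<close>.\<close>
  have rest: "int p dvd T w" if w: "w \<in> {..2*i} \<times> {..2*j} - {(i, j)}" for w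
  proof -
    obtain u v where uv: "w = (u, v)" "u \<le> 2*i" "v \<le> 2*j" "(u, v) \<noteq> (i, j)" using w by auto
    have "int p dvd moment p f u v \<or> int p dvd moment p f (2*i - u) (2*j - v)"
    proof (cases "u + v < i + j \<or> u + v = i + j \<and> u < i")
      case False
      then have "2*i - u + (2*j - v) < i + j \<or> 2*i - u + (2*j - v) = i + j \<and> 2*i - u < i"
        using uv by auto
      then show ?thesis using IH by blast
    qed (use IH in blast)
    then show ?thesis unfolding T_def uv by auto
  qed
  have "int p dvd (\<Sum>w\<in>{..2*i} \<times> {..2*j}. T w)"
    unfolding T_def double_sum_moments[symmetric]
    using 1(2) p1 by (intro planar_double_sum[OF p f]) arith
  also have "(\<Sum>w\<in>{..2*i} \<times> {..2*j}. T w) = T (i, j) + (\<Sum>w\<in>{..2*i} \<times> {..2*j} - {(i, j)}. T w)"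
    by (intro sum.remove) auto
  finally have "int p dvd T (i, j)"
    using dvd_sum[of "{..2*i} \<times> {..2*j} - {(i, j)}" "int p" T] rest by (simp add: dvd_add_left_iff)
  then have "int p dvd int (2*i choose i) * int (2*j choose j) * (-1) ^ (i + j) * moment p f i j * moment p f i j"
    unfolding T_def by simp
  moreover have "\<not> int p dvd int (2*i choose i)" "\<not> int p dvd int (2*j choose j)"
    using 1(2) p1 prime_not_dvd_choose[OF p, of "2*i" i] prime_not_dvd_choose[OF p, of "2*j" j]
    by auto
  moreover have "\<not> int p dvd (-1) ^ (i + j)"
    using p1 by (auto simp: minus_one_power_iff)
  ultimately show ?case using p by (simp add: prime_dvd_mult_iff)
qed

section \<open>Planar functions are quadratic\<close>

text \<open>The finite difference acts on the top coefficient like a derivative. The induction rests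
  on a discrete product rule: \<open>a + x * q\<close> has the difference
  \<open>q (x + 1) + x * (q (x + 1) - q x)\<close>.\<close>

lemma shift_diff_poly:
  fixes F :: "'a::idom poly"
  assumes "degree F \<le> Suc m"
  shows "degree (pcompose F [:1, 1:] - F) \<le> m \<and>
         coeff (pcompose F [:1, 1:] - F) m = of_nat (Suc m) * coeff F (Suc m)"
  using assms
proof (induction F arbitrary: m)
  case (pCons a q)
  let ?q = "pcompose q [:1, 1:]"
  have diff: "pcompose (pCons a q) [:1, 1:] - pCons a q = ?q + pCons 0 (?q - q)"
    by (simp add: pcompose_pCons poly_eq_iff coeff_pCons split: nat.splits)
  have dq: "degree q \<le> m" using pCons.prems by (cases "q = 0") auto
  show ?case
  proof (cases m)
    case 0
    then obtain c where "q = [:c:]" using dq by (metis degree_eq_zeroE le_zero_eq)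
    then show ?thesis unfolding diff using 0 by (simp add: pcompose_pCons)
  next
    case (Suc k)
    then have IH: "degree (?q - q) \<le> k" "coeff (?q - q) k = of_nat (Suc k) * coeff q (Suc k)"
      using pCons.IH[of k] dq by auto
    have "coeff (?q - q) (Suc k) = 0" using IH(1) by (intro coeff_eq_0) simp
    then have cq: "coeff ?q (Suc k) = coeff q (Suc k)" by simp
    have "degree ?q \<le> m" using dq by (simp add: degree_pcompose)
    moreover have "degree (pCons 0 (?q - q)) \<le> m" using IH(1) Suc
      by (intro degree_pCons_le[THEN order.trans]) simp
    ultimately have "degree (?q + pCons 0 (?q - q)) \<le> m" by (rule degree_add_le)
    moreover have "coeff (?q + pCons 0 (?q - q)) m = of_nat (Suc m) * coeff (pCons a q) (Suc m)"
      using IH(2) cq by (simp add: Suc coeff_pCons algebra_simps)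
    ultimately show ?thesis unfolding diff by simp
  qed
qed simp

lemma coeff_power2_double:
  fixes D :: "'a::idom poly"
  assumes "degree D \<le> m"
  shows "coeff (D ^ 2) (2 * m) = coeff D m ^ 2"
proof (cases "degree D = m")
  case True
  then show ?thesis using coeff_mult_degree_sum[of D D]
    by (simp add: power2_eq_square mult_2)
next
  case False
  then have "degree (D ^ 2) < 2 * m" "degree D < m"
    using assms degree_power_le[of D 2] by linarith+
  then show ?thesis by (simp add: coeff_eq_0)
qed

lemma planar_imp_quadratic:
  assumes p: "prime p" and f: "planar p f"
  obtains a b c :: int where "p > 2" and "\<not> int p dvd a"
    and "\<And>x. x < p \<Longrightarrow> [f x = a * int x ^ 2 + b * int x + c] (mod int p)"
proof -
  have p1: "p > 1" using p by (rule prime_gt_1_nat)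
  obtain F :: "int poly" where F: "degree F \<le> p - 1"
    "\<And>x. x < p \<Longrightarrow> [poly F (int x) = f x] (mod int p)"
    "F = 0 \<or> \<not> int p dvd lead_coeff F"
    using interpolation_mod_prime[OF p, of f] by blast
  define n where "n = degree F"
  define l where "l = lead_coeff F"
  have pcong: "[poly F (int x) = poly F (int y)] (mod int p)" if "[int x = int y] (mod int p)" for x y
  proof -
    have "poly F (int x) = (\<Sum>i\<le>n. coeff F i * int x ^ i)" by (simp add: n_def poly_altdef)
    also have "[\<dots> = (\<Sum>i\<le>n. coeff F i * int y ^ i)] (mod int p)"
      by (intro cong_sum cong_scalar_left cong_pow that)
    finally show ?thesis by (simp add: n_def poly_altdef)
  qed
  have step: "[poly F (int y + 1) - poly F (int y) = f ((y + 1) mod p) - f y] (mod int p)"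
    if "y < p" for y
  proof -
    have "[poly F (int (y + 1)) = poly F (int ((y + 1) mod p))] (mod int p)"
      by (rule pcong) (simp add: cong_def zmod_int)
    also have "[poly F (int ((y + 1) mod p)) = f ((y + 1) mod p)] (mod int p)"
      using p1 by (intro F) auto
    finally show ?thesis using F(2)[OF that] by (intro cong_diff) (auto simp: add.commute)
  qed
  \<comment> \<open>A polynomial of degree at most \<open>1\<close> has constant differences, so the
    shift by \<open>1\<close> gives equal values at \<open>0\<close> and \<open>1\<close>. As
    \<open>n \<le> p - 1\<close>, this also excludes \<open>p = 2\<close>.\<close>
  have n2: "n \<ge> 2"
  proof (rule ccontr)
    assume "\<not> n \<ge> 2"
    then have "degree F \<le> 1" by (simp add: n_def)
    then have lin: "poly F x = coeff F 0 + coeff F 1 * x" for x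
      by (subst poly_altdef_le) auto
    have "[coeff F 1 = f ((y + 1) mod p) - f y] (mod int p)" if "y < p" for y
      using step[OF that] by (simp add: lin algebra_simps)
    then have "(f ((0 + 1) mod p) - f 0) mod int p = (f ((1 + 1) mod p) - f 1) mod int p"
      using p1 unfolding cong_def by (metis less_trans zero_less_one)
    moreover have "inj_on (\<lambda>y. (f ((y + 1) mod p) - f y) mod int p) {..<p}"
      using f p1 unfolding planar_def by (intro bij_betw_imp_inj_on) force
    ultimately have "(0::nat) = 1" using p1 by (elim inj_onD) auto
    then show False by simp
  qed
  have F0: "F \<noteq> 0" using n2 by (auto simp: n_def)
  have l: "\<not> int p dvd l" using F(3) F0 by (simp add: l_def)
  have "n \<le> 2"
  proof (rule ccontr)
    assume "\<not> n \<le> 2"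
    then have n3: "n \<ge> 3" by simp
    \<comment> \<open>Chosen so that \<open>F ^ i * x ^ r\<close> has degree exactly
      \<open>p - 1\<close>; its sum over the field is then \<open>- (l ^ i)\<close>, which
      \<open>p\<close> does not divide.\<close>
    define i where "i = (p - 1) div n"
    define r where "r = (p - 1) mod n"
    have ir: "p - 1 = n * i + r" "r < n" using n3 by (auto simp: i_def r_def)
    have i1: "i \<ge> 1" using F(1) n3 unfolding i_def n_def
      by (metis One_nat_def div_greater_zero_iff less_eq_Suc_le not_less_eq_eq numeral_3_eq_3 zero_less_Suc less_le_trans)
    define G where "G = F ^ i * monom 1 r"
    have dG: "degree G = p - 1" unfolding ir(1) using F0
      unfolding ir(1) by (simp add: G_def degree_mult_eq degree_power_eq degree_monom_eq monom_eq_0_iff n_def)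
    have "lead_coeff G = l ^ i"
      by (simp add: G_def lead_coeff_mult lead_coeff_power l_def degree_monom_eq)
    then have "[(\<Sum>x<p. poly G (int x)) = - (l ^ i)] (mod int p)"
      using sum_poly_mod_prime[OF p, of G] dG by simp
    moreover have "[(\<Sum>x<p. poly G (int x)) = moment p f i r] (mod int p)"
      unfolding moment_def G_def poly_mult poly_power poly_monom mult_1
      by (intro cong_sum cong_scalar_right cong_pow F) simp
    ultimately have "[moment p f i r = - (l ^ i)] (mod int p)"
      using cong_sym cong_trans by blast
    moreover have "\<not> int p dvd - (l ^ i)"
      using l p prime_dvd_power[of "int p" l i] by auto
    ultimately have "\<not> int p dvd moment p f i r" by (simp add: cong_dvd_iff)
    \<comment> \<open>The nonzero moment must lie outside the range of
      \<open>planar_moments\<close>; inserting \<open>p = n * i + r + 1\<close> yields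
      \<open>(n - 2) * i \<le> r\<close>.\<close>
    then have "\<not> 2 * (i + r) \<le> p - 2" using planar_moments[OF p f] by blast
    then have "p \<le> 2 * (i + r) + 1" by arith
    moreover have "p = n * i + r + 1" using ir p1 by linarith
    ultimately have "n * i \<le> 2 * i + r" by simp
    then have ineq: "(n - 2) * i \<le> r" by (simp add: diff_mult_distrib)
    \<comment> \<open>For \<open>i \<ge> 2\<close>, the bounds
      \<open>2 * (n - 2) \<le> r < n\<close> leave only \<open>n = 3\<close>, \<open>r = 2\<close>
      and \<open>i = 2\<close>, that is \<open>p = 9\<close>.\<close>
    have "i = 1"
    proof (rule ccontr)
      assume "i \<noteq> 1"
      then have i2: "i \<ge> 2" using i1 by simp
      have "(n - 2) * 2 \<le> (n - 2) * i" using i2 by (intro mult_left_mono) auto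
      then have n: "n = 3" and "r = 2" using ineq ir(2) n3 by linarith+
      then have "i = 2" using ineq i2 by simp
      then have "p = 9" using ir n \<open>r = 2\<close> p1 by simp
      moreover have "\<not> prime (9::nat)"
by (auto simp: prime_nat_iff intro!: exI[of _ 3])
      ultimately show False using p by simp
    qed
    \<comment> \<open>From \<open>n - 2 \<le> r < n\<close>, \<open>p\<close> is
      \<open>2 * n - 1\<close> or \<open>2 * n\<close>, and parity selects the former.\<close>
    have "p = n + r + 1" "n - 2 \<le> r" using ir(1) ineq p1 \<open>i = 1\<close> by simp_all
    moreover have "odd p" using p ir n3 i1 prime_odd_nat[of p] \<open>i = 1\<close> by simp
    ultimately have pn: "p = 2 * (n - 1) + 1"
      using ir(2) n3 by presburger
    \<comment> \<open>\<open>D ^ 2\<close> has the coefficient \<open>(n * l) ^ 2\<close> at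
      exponent \<open>2 * (n - 1) = p - 1\<close>. Planarity forces \<open>p\<close> to divide it,
      although \<open>0 < n < p\<close>.\<close>
    define D where "D = pcompose F [:1, 1:] - F"
    have "degree F \<le> Suc (n - 1)" using n3 by (simp add: n_def)
    from shift_diff_poly[OF this] have dD: "degree D \<le> n - 1"
      and "coeff D (n - 1) = of_nat (Suc (n - 1)) * coeff F (Suc (n - 1))"
      unfolding D_def by auto
    then have cD: "coeff D (n - 1) = int n * l" using n3 by (simp add: l_def n_def)
    have "[(\<Sum>x<p. poly (D ^ 2) (int x)) = - coeff (D ^ 2) (p - 1)] (mod int p)"
      using pn dD degree_power_le[of D 2] by (intro sum_poly_mod_prime[OF p]) simp
    moreover have "[(\<Sum>x<p. poly (D ^ 2) (int x)) = (\<Sum>x<p. (f ((x + 1) mod p) - f x) ^ 2)] (mod int p)"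
      using step by (intro cong_sum) (auto simp: D_def poly_pcompose add.commute intro!: cong_pow)
    moreover have "int p dvd (\<Sum>x<p. (f ((x + 1) mod p) - f x) ^ 2)"
      using pn n3 p1 by (intro planar_sum_powers[OF p f]) auto
    ultimately have "int p dvd coeff (D ^ 2) (p - 1)"
      by (metis cong_dvd_iff dvd_minus_iff)
    then have "int p dvd (int n * l) ^ 2"
      using coeff_power2_double[OF dD] pn cD by simp
    then have "int p dvd int n" using l p by (auto simp: prime_dvd_mult_iff power2_eq_square)
    then have "p dvd n" by simp
    then show False using F(1) p1 n3 by (auto simp: n_def dest!: dvd_imp_le)
  qed
  then have n: "n = 2" using n2 by simp
  show ?thesis
  proof (rule that)
    show "p > 2" using F(1) n n_def p1 by simp
    show "\<not> int p dvd coeff F 2" using l n by (simp add: l_def n_def)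
    fix x assume x: "x < p"
    have "poly F (int x) = coeff F 2 * int x ^ 2 + coeff F 1 * int x + coeff F 0"
      using n by (subst poly_altdef_le[of F 2]) (auto simp: n_def numeral_2_eq_2)
    then show "[f x = coeff F 2 * int x ^ 2 + coeff F 1 * int x + coeff F 0] (mod int p)"
      using F(2)[OF x] by (simp add: cong_sym)
  qed
qed

subsection \<open>Vanishing sums of roots of unity of prime order\<close>

text \<open>Eisenstein's criterion for a given factorization. By \<open>const\<close>,
  \<open>q\<close> misses one of the two constant coefficients; if that factor were not constant,
  \<open>q\<close> would divide all coefficients of the other one, contradicting
  \<open>lead\<close>.\<close>

lemma eisenstein_factor_trivial:
  fixes A B :: "'a::{factorial_semiring,idom} poly"
  assumes q: "prime_elem q"
    and low: "\<And>k. k < degree (A * B) \<Longrightarrow> q dvd coeff (A * B) k"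
    and lead: "\<not> q dvd lead_coeff (A * B)"
    and const: "\<not> q ^ 2 dvd coeff (A * B) 0"
  shows "degree A = 0 \<or> degree B = 0"
proof -
  have aux: "degree U = 0"
    if UV: "U * V = A * B" and U0: "\<not> q dvd coeff U 0" for U V
  proof (rule ccontr)
    assume U: "degree U \<noteq> 0"
    have nz: "U \<noteq> 0" "V \<noteq> 0" using lead UV by auto
    \<comment> \<open>This strict bound lets \<open>low\<close> cover every index up to
      \<open>degree V\<close>.\<close>
    have dV: "degree V < degree (A * B)" using U nz by (simp flip: UV add: degree_mult_eq)
    have "q dvd coeff V k" if "k \<le> degree V" for k
      using that
    proof (induction k rule: less_induct)
      case (less k)
      have "coeff (A * B) k = (\<Sum>i\<le>k. coeff U i * coeff V (k - i))"
        by (simp flip: UV add: coeff_mult)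
      also have "{..k} = insert 0 {1..k}" by auto
      also have "(\<Sum>i\<in>insert 0 {1..k}. coeff U i * coeff V (k - i)) =
          coeff U 0 * coeff V k + (\<Sum>i=1..k. coeff U i * coeff V (k - i))" by simp
      finally have "q dvd coeff U 0 * coeff V k + (\<Sum>i=1..k. coeff U i * coeff V (k - i))"
        using low[of k] less.prems dV by simp
      moreover have "q dvd (\<Sum>i=1..k. coeff U i * coeff V (k - i))"
        using less by (intro dvd_sum dvd_mult less.IH) auto
      ultimately have "q dvd coeff U 0 * coeff V k" by (simp add: dvd_add_left_iff)
      then show ?case using U0 q by (simp add: prime_elem_dvd_mult_iff)
    qed
    then have "q dvd lead_coeff (U * V)" by (simp add: lead_coeff_mult)
    then show False using lead UV by simp
  qed
  have "\<not> (q dvd coeff A 0 \<and> q dvd coeff B 0)"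
    using const mult_dvd_mono by (fastforce simp: coeff_mult_0 power2_eq_square)
  then show ?thesis using aux[of A B] aux[of B A] by (auto simp: mult.commute)
qed

section \<open>Evaluating integer polynomials at complex numbers\<close>

abbreviation ipoly :: "int poly \<Rightarrow> complex \<Rightarrow> complex" where
  "ipoly Q \<equiv> poly (map_poly of_int Q)"

lemma ipoly_pCons: "ipoly (pCons a Q) z = of_int a + z * ipoly Q z"
  by (simp add: map_poly_pCons)

lemma ipoly_add: "ipoly (P + Q) z = ipoly P z + ipoly Q z"
proof -
  have "map_poly of_int (P + Q) = map_poly of_int P + (map_poly of_int Q :: complex poly)"
    by (simp add: poly_eq_iff coeff_map_poly)
  then show ?thesis by simp
qed

lemma ipoly_smult: "ipoly (smult a Q) z = of_int a * ipoly Q z"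
  by (simp add: map_poly_smult)

lemma ipoly_mult: "ipoly (P * Q) z = ipoly P z * ipoly Q z"
  by (induction P) (simp_all add: ipoly_pCons ipoly_add ipoly_smult algebra_simps)

lemma ipoly_sum: "ipoly (\<Sum>i\<in>A. f i) z = (\<Sum>i\<in>A. ipoly (f i) z)"
  by (induction A rule: infinite_finite_induct) (simp_all add: ipoly_add)

lemma ipoly_pcompose: "ipoly (pcompose P Q) z = ipoly P (ipoly Q z)"
  by (induction P) (simp_all add: pcompose_pCons ipoly_pCons ipoly_add ipoly_mult)

text \<open>
  The shift to \<open>w - 1\<close> makes Eisenstein's criterion applicable: \<open>w - 1\<close> is a root of
  \<open>((x + 1) ^ p - 1) / x\<close>.
\<close>
lemma primitive_root_minus_1_independent:
  fixes w :: complex and Q :: "int poly"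
  assumes p: "prime p" and w: "w ^ p = 1" "w \<noteq> 1"
    and Q: "degree Q < p - 1" "ipoly Q (w - 1) = 0"
  shows "Q = 0"
proof (rule ccontr)
  assume Q0: "Q \<noteq> 0"
  define y where "y = w - 1"
  have y0: "y \<noteq> 0" using w by (simp add: y_def)
  have p1: "p > 1" using p by (rule prime_gt_1_nat)
  let ?root = "\<lambda>R :: int poly. R \<noteq> 0 \<and> ipoly R y = 0"
  \<comment> \<open>\<open>R0\<close> plays the role of a minimal polynomial of \<open>y\<close>
    over the integers; its primitive part \<open>R\<close> is taken so that Gauss's lemma
    applies.\<close>
  define R0 where "R0 = arg_min degree ?root"
  have R0: "?root R0" and R0_min: "\<And>S. ?root S \<Longrightarrow> degree R0 \<le> degree S"
    using arg_min_nat_lemma[of ?root Q degree] Q0 Q(2) unfolding R0_def y_def by auto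
  define R where "R = primitive_part R0"
  have R: "R \<noteq> 0" "degree R = degree R0" "content R = 1"
    using R0 by (auto simp: R_def)
  have "R0 = smult (content R0) R" by (simp add: R_def)
  then have "of_int (content R0) * ipoly R y = 0"
    using R0 by (metis ipoly_smult)
  then have Ry: "ipoly R y = 0" using R0 by auto
  define P where "P = (\<Sum>i<p. monom (int (p choose Suc i)) i)"
  have cP: "coeff P i = int (p choose Suc i)" if "i < p" for i
    using that by (simp add: P_def coeff_sum)
  have dP: "degree P = p - 1"
  proof (rule antisym)
    show "degree P \<le> p - 1" unfolding P_def
      by (intro degree_sum_le) (auto intro: order.trans[OF degree_monom_le])
    show "p - 1 \<le> degree P" using cP[of "p - 1"] p1 by (intro le_degree) simp
  qed
  have "ipoly P y * y = (\<Sum>i<p. of_nat (p choose Suc i) * y ^ Suc i)"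
    by (simp add: P_def ipoly_sum map_poly_monom poly_monom sum_distrib_left mult_ac)
  also have "\<dots> = (y + 1) ^ p - 1"
    unfolding binomial_ring[of y 1 p] lessThan_Suc_atMost[symmetric] sum.lessThan_Suc_shift by simp
  finally have Py: "ipoly P y = 0" using w y0 by (simp add: y_def)
  \<comment> \<open>Pseudo-division is used because \<open>R\<close> may fail to be monic. The
    remainder vanishes at \<open>y\<close> and is \<open>0\<close> by minimality of the
    degree.\<close>
  obtain a S where a: "a \<noteq> 0" and S: "smult a P = R * S + pseudo_mod P R"
    using pseudo_mod(1)[OF R(1), of P] by blast
  have "ipoly (pseudo_mod P R) y = 0"
    using arg_cong[OF S, of "\<lambda>U. ipoly U y"] Ry Py by (simp add: ipoly_add ipoly_mult ipoly_smult)
  then have "pseudo_mod P R = 0"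
    using pseudo_mod(2)[OF R(1), of P] R0_min R(2) by fastforce
  then have aP: "smult a P = R * S" using S by simp
  \<comment> \<open>Gauss's lemma: since \<open>R\<close> is primitive, \<open>a\<close> divides
    \<open>S\<close> and cancels, so \<open>R\<close> divides \<open>P\<close> over the
    integers.\<close>
  then have "content S = content (smult a P)" using R(3) by (simp add: content_mult)
  then have "a dvd content S" by simp
  then have "[:a:] dvd S" by (simp add: const_poly_dvd_iff_dvd_content)
  then obtain T where "S = smult a T" by (auto elim!: dvdE)
  then have "smult a P = smult a (R * T)" using aP by simp
  then have PRT: "P = R * T" using a by (metis smult_eq_0_iff smult_diff_right right_minus_eq)
  have "degree R = 0 \<or> degree T = 0"
  proof (rule eisenstein_factor_trivial)
    show "prime_elem (int p)" using p by simp
    show "\<not> int p dvd lead_coeff (R * T)"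
      using p1 by (simp flip: PRT add: dP cP)
    show "\<not> (int p)\<^sup>2 dvd coeff (R * T) 0"
      using p1 by (simp flip: PRT add: cP power2_eq_square)
    fix k assume "k < degree (R * T)"
    then have "k < p - 1" by (simp flip: PRT add: dP)
    then show "int p dvd coeff (R * T) k"
      using dvd_choose_prime[of "Suc k" p] p p1 by (simp flip: PRT add: cP)
  qed
  moreover have "degree R \<noteq> 0"
  proof
    assume "degree R = 0"
    then obtain c where "R = [:c:]" by (rule degree_eq_zeroE)
    then show False using Ry R(1) by (simp add: ipoly_pCons)
  qed
  ultimately have "degree R = p - 1" using PRT dP R(1)
    by (metis add.right_neutral degree_0 degree_mult_eq mult_zero_right p1 zero_less_diff less_irrefl)
  then show False using R0_min[of Q] Q Q0 R(2) unfolding y_def by auto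
qed

text \<open>Subtracting \<open>N (p - 1)\<close> times the vanishing sum of all powers of
  \<open>w\<close> leaves an integer polynomial of degree below \<open>p - 1\<close> with root
  \<open>w\<close>. Its shift by \<open>1\<close> has root \<open>w - 1\<close>, hence is
  zero.\<close>

lemma vanishing_sum_prime_root:
  fixes w :: complex and N :: "nat \<Rightarrow> int"
  assumes p: "prime p" and w: "w ^ p = 1" "w \<noteq> 1"
    and sum0: "(\<Sum>c<p. of_int (N c) * w ^ c) = 0" and c: "c < p"
  shows "N c = N (p - 1)"
proof (cases "c = p - 1")
  case False
  have p1: "p > 1" using p by (rule prime_gt_1_nat)
  define P where "P = (\<Sum>c<p-1. monom (N c - N (p - 1)) c)"
  have "degree P \<le> p - 2" unfolding P_def
    by (intro degree_sum_le) (auto intro!: order.trans[OF degree_monom_le])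
  then have dP: "degree P < p - 1" using p1 by linarith
  have "ipoly P w = (\<Sum>c<p-1. of_int (N c - N (p - 1)) * w ^ c)"
    by (simp add: P_def ipoly_sum map_poly_monom poly_monom)
  also have "\<dots> = (\<Sum>c<p. of_int (N c - N (p - 1)) * w ^ c)"
    by (intro sum.mono_neutral_left) (auto simp: less_Suc_eq_le dest!: leI le_antisym)
  also have "\<dots> = (\<Sum>c<p. of_int (N c) * w ^ c) - of_int (N (p - 1)) * (\<Sum>c<p. w ^ c)"
    by (simp add: ring_distribs sum_subtractf sum_distrib_left)
  also have "\<dots> = 0" using sum0 w by (simp add: sum_gp_strict)
  finally have "ipoly (pcompose P [:1, 1:]) (w - 1) = 0"
    by (simp add: ipoly_pcompose ipoly_pCons)
  then have "pcompose P [:1, 1:] = 0"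
    using dP by (intro primitive_root_minus_1_independent[OF p w]) (simp_all add: degree_pcompose)
  then have "P = 0" by (simp add: pcompose_eq_0_iff)
  moreover have "coeff P c = N c - N (p - 1)"
    using False c by (auto simp: P_def coeff_sum)
  ultimately show ?thesis by simp
qed simp

subsection \<open>Circulant Hadamard matrices of prime order\<close>

text \<open>Orthogonality of the rows \<open>p - d\<close> and \<open>0\<close> is a vanishing sum
  of powers of \<open>w\<close>, where the coefficient of \<open>w ^ c\<close> counts the
  \<open>y\<close> whose difference is \<open>c\<close>. All these counts are therefore
  equal.\<close>

lemma circ_hadamard_planar:
  fixes w :: complex and e :: "nat \<Rightarrow> nat"
  assumes p: "prime p" and w: "w ^ p = 1" "w \<noteq> 1"
    and H: "complex_hadamard p H" "circulant p H"
    and e: "\<And>y. y < p \<Longrightarrow> e y < p" "\<And>y. y < p \<Longrightarrow> H 0 y = w ^ e y"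
  shows "planar p (\<lambda>y. int (e y))"
  unfolding planar_def
proof
  fix d assume d: "d \<in> {1..<p}"
  have p0: "p > 0" using p by (rule prime_gt_0_nat)
  have "w \<noteq> 0" using w(1) p0 by (auto simp: power_0_left)
  have "norm w ^ p = 1" using w(1) by (metis norm_power norm_one)
  then have "norm w = 1" using p0 power_eq_imp_eq_base[of "norm w" p 1] by simp
  have cnj: "cnj (w ^ a) = w ^ (p - a)" if "a \<le> p" for a
  proof -
    have "cnj (w ^ a) * w ^ a = 1"
      using \<open>norm w = 1\<close> complex_norm_square[of "w ^ a"] by (simp add: norm_power mult.commute)
    also have "\<dots> = w ^ (p - a) * w ^ a" using that w(1) by (simp flip: power_add)
    finally show ?thesis using \<open>w \<noteq> 0\<close> by simp
  qed
  \<comment> \<open>The difference \<open>e (y + d) - e y\<close> mod \<open>p\<close>, with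
    \<open>p\<close> added to avoid truncated subtraction; \<open>p - e y\<close> is also the
    exponent given by \<open>cnj\<close>.\<close>
  let ?g = "\<lambda>y. (e ((y + d) mod p) + (p - e y)) mod p"
  have wmod: "w ^ (a mod p) = w ^ a" for a
    using w(1) by (metis mult_div_mod_eq mult_1 power_add power_mult power_one)
  have row: "H (p - d) y = H 0 ((y + d) mod p)" if "y < p" for y
  proof -
    have "(int y - int (p - d)) mod int p = (int ((y + d) mod p) - int 0) mod int p"
    proof -
      have "int y - int (p - d) = int (y + d) - int p" using d by (simp add: of_nat_diff)
      then show ?thesis by (simp only: zmod_int minus_mod_self2 of_nat_0 diff_0_right mod_mod_trivial)
    qed
    then show ?thesis using H(2) that d p0 unfolding circulant_def by (auto simp del: of_nat_0)
  qed
  have "0 = (\<Sum>y<p. H (p - d) y * cnj (H 0 y))"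
    using H(1) d p0 unfolding complex_hadamard_def by auto
  also have "\<dots> = (\<Sum>y<p. w ^ ?g y)"
  proof (intro sum.cong refl)
    fix y assume "y \<in> {..<p}"
    then show "H (p - d) y * cnj (H 0 y) = w ^ ?g y"
      using p0 e(1)[of y]
      by (simp add: row e(2) wmod power_add cnj del: complex_cnj_power Nat.add_diff_assoc)
  qed
  also have "\<dots> = (\<Sum>c<p. of_nat (card {y\<in>{..<p}. ?g y = c}) * w ^ c)"
    using p0 by (intro sum_fun_comp) auto
  finally have "(\<Sum>c<p. of_int (int (card {y\<in>{..<p}. ?g y = c})) * w ^ c) = 0" by simp
  note const_int = vanishing_sum_prime_root[OF p w this]
  have const: "card {y\<in>{..<p}. ?g y = c} = card {y\<in>{..<p}. ?g y = p - 1}" if "c < p" for c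
    using const_int[OF that] by (simp only: of_nat_eq_iff)
  \<comment> \<open>With equal counts one empty fibre would make all fibres empty, but the fibre
    over \<open>?g 0\<close> contains \<open>0\<close>.\<close>
  have "c \<in> ?g ` {..<p}" if c: "c < p" for c
  proof (rule ccontr)
    assume "c \<notin> ?g ` {..<p}"
    then have empty: "{y\<in>{..<p}. ?g y = c} = {}" by auto
    have "card {y\<in>{..<p}. ?g y = ?g 0} = card {y\<in>{..<p}. ?g y = c}"
      using const[OF c] const[of "?g 0"] p0 by (simp only: mod_less_divisor)
    also have "\<dots> = 0" by (simp only: empty card.empty)
    finally have "{y\<in>{..<p}. ?g y = ?g 0} = {}" by (subst (asm) card_0_eq) auto
    then show False using p0 by blast
  qed
  then have surj: "?g ` {..<p} = {..<p}" using p0 by auto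
  then have "bij_betw ?g {..<p} {..<p}"
    by (simp add: bij_betw_def eq_card_imp_inj_on)
  moreover have "bij_betw int {..<p} {0..<int p}"
    by (rule bij_betwI[of _ _ _ nat]) auto
  ultimately have "bij_betw (int \<circ> ?g) {..<p} {0..<int p}"
    by (rule bij_betw_trans)
  moreover have "(int \<circ> ?g) y = (int (e ((y + d) mod p)) - int (e y)) mod int p" if "y \<in> {..<p}" for y
  proof -
    let ?z = "int (e ((y + d) mod p))"
    have "int (e ((y + d) mod p) + (p - e y)) = (?z - int (e y)) + int p"
      using that e(1)[of y] by (simp add: of_nat_diff)
    then show ?thesis by (simp only: comp_apply zmod_int mod_add_self2)
  qed
  ultimately show "bij_betw (\<lambda>y. (int (e ((y + d) mod p)) - int (e y)) mod int p) {..<p} {0..<int p}"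
    by (subst (asm) bij_betw_cong) auto
qed

lemma power_int_mod_cong:
  fixes w :: complex
  assumes "w ^ p = 1" "w \<noteq> 0" "[a = b] (mod int p)"
  shows "w powi a = w powi b"
proof -
  obtain k where "a = b + int p * k" using cong_sym[OF assms(3)] by (auto simp: cong_iff_lin)
  then show ?thesis using assms(1,2) by (simp add: power_int_add power_int_mult)
qed

theorem theorem1p2:
  fixes p :: nat and H :: "nat \<Rightarrow> nat \<Rightarrow> complex"
  assumes "prime p"
    and "H \<in> circ_hadamard_set p p"
  shows "hadamard_equivalent p H (fourier_matrix p)"
proof -
  note p = assms(1)
  have p1: "p > 1" using p by (rule prime_gt_1_nat)
  have H: "complex_hadamard p H" "circulant p H" "\<And>i j. i < p \<Longrightarrow> j < p \<Longrightarrow> H i j ^ p = 1"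
    using assms(2) by (auto simp: circ_hadamard_set_def entries_roots_of_unity_def)
  define w where "w = cis (2 * pi / real p)"
  have wk: "w ^ k = cis (2 * pi * real k / real p)" for k
    unfolding w_def Complex.DeMoivre by (simp add: mult_ac)
  have roots: "bij_betw (\<lambda>k. w ^ k) {..<p} {z. z ^ p = 1}"
    using Complex.bij_betw_roots_unity[of p] p1 by (simp add: wk)
  have wp: "w ^ p = 1" using p1 by (simp add: wk)
  have w1: "w \<noteq> 1"
    using inj_onD[OF bij_betw_imp_inj_on[OF roots], of 1 0] p1 by auto
  have w0: "w \<noteq> 0" by (simp add: w_def)
  have "\<exists>k<p. H 0 y = w ^ k" if "y < p" for y
    using bij_betw_imp_surj_on[OF roots] H(3)[of 0 y] that p1 by fastforce
  then obtain e where e: "\<And>y. y < p \<Longrightarrow> e y < p" "\<And>y. y < p \<Longrightarrow> H 0 y = w ^ e y"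
    by metis
  obtain a b c :: int where "p > 2" and a: "\<not> int p dvd a"
    and quad: "\<And>x. x < p \<Longrightarrow> [int (e x) = a * int x ^ 2 + b * int x + c] (mod int p)"
    using planar_imp_quadratic[OF p circ_hadamard_planar[OF p wp w1 H(1,2) e]] by blast
  \<comment> \<open>The cross term of \<open>a * (j - i) ^ 2\<close> is
    \<open>(- 2 * a * i) * j\<close>, so \<open>\<sigma> i\<close> is the Fourier row matching row
    \<open>i\<close>. It is injective mod \<open>p\<close> since \<open>p > 2\<close> and
    \<open>p\<close> does not divide \<open>a\<close>; \<open>permutes\<close> demands the identity
    outside the range.\<close>
  define \<sigma> where "\<sigma> i = (if i < p then nat ((- 2 * a * int i) mod int p) else i)" for i
  have s: "int (\<sigma> i) = (- 2 * a * int i) mod int p" if "i < p" for i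
    using that p1 by (simp add: \<sigma>_def)
  have "inj_on \<sigma> {..<p}"
  proof (rule inj_onI)
    fix i j assume ij: "i \<in> {..<p}" "j \<in> {..<p}" "\<sigma> i = \<sigma> j"
    then have "[- 2 * a * int i = - 2 * a * int j] (mod int p)"
      using s[of i] s[of j] by (simp add: cong_def)
    then have "int p dvd - 2 * a * (int i - int j)"
      by (simp add: cong_iff_dvd_diff algebra_simps)
    moreover have "\<not> int p dvd 2" using \<open>p > 2\<close> by (auto dest: zdvd_imp_le)
    ultimately have "int p dvd int i - int j" using a p by (simp add: prime_dvd_mult_iff)
    then have "[int i = int j] (mod int p)" by (simp add: cong_iff_dvd_diff)
    then show "i = j" using ij by (simp add: cong_def)
  qed
  moreover have "\<sigma> ` {..<p} \<subseteq> {..<p}"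
    using p1 by (auto simp: \<sigma>_def nat_less_iff)
  ultimately have "bij_betw \<sigma> {..<p} {..<p}" by (simp add: bij_betw_def endo_inj_surj)
  then have perm: "\<sigma> permutes {..<p}" by (rule bij_imp_permutes) (simp add: \<sigma>_def)
  \<comment> \<open>The remaining terms of the quadratic in \<open>j - i\<close>, split into those
    depending on \<open>i\<close>, with the constant, and those depending on \<open>j\<close>. The
    exponents may be negative, hence \<open>powi\<close>.\<close>
  define u where "u i = w powi (a * int i ^ 2 - b * int i + c)" for i :: nat
  define v where "v j = w powi (a * int j ^ 2 + b * int j)" for j :: nat
  have "H i j = u i * v j * fourier_matrix p (\<sigma> i) (id j)" if ij: "i < p" "j < p" for i j
  proof -
    \<comment> \<open>The column where row \<open>0\<close> carries the entry
      \<open>H i j\<close>.\<close>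
    define m where "m = (j + (p - i)) mod p"
    have m: "m < p" "int m = (int j - int i) mod int p"
    proof -
      have "int (j + (p - i)) = (int j - int i) + int p" using ij by (simp add: of_nat_diff)
      then show "int m = (int j - int i) mod int p" by (simp only: m_def zmod_int mod_add_self2)
    qed (use p1 in \<open>simp add: m_def\<close>)
    have mc: "[int m = int j - int i] (mod int p)" by (simp add: m(2) cong_def)
    have "(int j - int i) mod int p = (int m - int 0) mod int p" by (simp add: m(2))
    then have "H i j = H 0 m" using H(2)[unfolded circulant_def, rule_format, of i j 0 m] ij m(1) p1 by simp
    also have "\<dots> = w powi int (e m)" using e(2)[OF m(1)] by simp
    also have "\<dots> = w powi ((a * int i ^ 2 - b * int i + c) + (a * int j ^ 2 + b * int j) + int (\<sigma> i) * int j)"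
    proof (rule power_int_mod_cong[OF wp w0])
      have "[int (e m) = a * int m ^ 2 + b * int m + c] (mod int p)" by (rule quad[OF m(1)])
      also have "[a * int m ^ 2 + b * int m + c = a * (int j - int i) ^ 2 + b * (int j - int i) + c] (mod int p)"
        by (intro cong_add cong_scalar_left cong_pow mc cong_refl)
      also have "a * (int j - int i) ^ 2 + b * (int j - int i) + c =
          (a * int i ^ 2 - b * int i + c) + (a * int j ^ 2 + b * int j) + (- 2 * a * int i) * int j"
        by (simp add: power2_eq_square algebra_simps)
      also have "[\<dots> = (a * int i ^ 2 - b * int i + c) + (a * int j ^ 2 + b * int j) + int (\<sigma> i) * int j] (mod int p)"
        unfolding s[OF ij(1)] by (intro cong_add cong_scalar_right cong_refl) (simp add: cong_def)
      finally show "[int (e m) = (a * int i ^ 2 - b * int i + c) + (a * int j ^ 2 + b * int j) + int (\<sigma> i) * int j] (mod int p)" .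
    qed
    also have "\<dots> = u i * v j * fourier_matrix p (\<sigma> i) (id j)"
      using w0 by (simp add: u_def v_def fourier_matrix_def power_int_add flip: w_def of_nat_mult)
    finally show ?thesis .
  qed
  moreover have "norm (u i) = 1" "norm (v i) = 1" for i
    by (simp_all add: u_def v_def w_def norm_power_int)
  ultimately show ?thesis
    unfolding hadamard_equivalent_def using perm permutes_id by blast
qed

end
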